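(* Let $H$ be a fixed disconnected graph with $m(H)=1$ and at least two unicyclic components. Then $f^+_H(n)=O(n)$ as $n\to\infty$.
   Context: All graphs are finite and simple; the implied constant may depend on $H$. A graph is unicyclic if it is connected and contains exactly one cycle. $m(H)=\max_{F\subseteq H,\ v(F)\ge 1} e(F)/v(F)$, where $v(F)$ and $e(F)$ are the numbers of vertices and edges of $F$. In the $(1:b)$ (strict) Avoider--Enforcer $H$-game on $K_n$ ($n,b$ positive integers), Avoider and Enforcer alternately claim previously unclaimed edges of $K_n$, Avoider moving first. Avoider claims exactly one edge per turn and Enforcer claims exactly $b$ edges per turn; if strictly fewer than $b$ edges are unclaimed before a move of Enforcer, he claims all of them. The game ends when all edges are claimed. Avoider loses (Enforcer wins) if the graph of Avoider's edges then contains a copy of $H$; otherwise Avoider wins. The upper threshold $f^+_H(n)$ is the largest integer $b$ such that Enforcer has a winning strategy in the $(1:b)$ $H$-game on $K_n$. *)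

theory Defs
  imports Complex_Main "HOL-Library.Landau_Symbols"
begin

record 'a graph =
  verts :: "'a set"
  edges :: "'a set set"

definition simple_graph :: "'a graph \<Rightarrow> bool" where
  "simple_graph G \<longleftrightarrow> finite (verts G) \<and> (\<forall>e\<in>edges G. e \<subseteq> verts G \<and> card e = 2)"

definition subgraph :: "'a graph \<Rightarrow> 'a graph \<Rightarrow> bool" where
  "subgraph F G \<longleftrightarrow> simple_graph F \<and> verts F \<subseteq> verts G \<and> edges F \<subseteq> edges G"

definition connected_graph :: "'a graph \<Rightarrow> bool" where
  "connected_graph G \<longleftrightarrow> verts G \<noteq> {} \<and>
     (\<forall>u\<in>verts G. \<forall>v\<in>verts G. (u, v) \<in> {(x, y). {x, y} \<in> edges G}\<^sup>*)"

definition component :: "'a graph \<Rightarrow> 'a graph \<Rightarrow> bool" where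
  "component C G \<longleftrightarrow> subgraph C G \<and> connected_graph C \<and>
     (\<forall>D. subgraph D G \<and> connected_graph D \<and> subgraph C D \<longrightarrow> D = C)"

definition cycle_graph :: "'a graph \<Rightarrow> bool" where
  "cycle_graph C \<longleftrightarrow> (\<exists>vs. distinct vs \<and> 3 \<le> length vs \<and> verts C = set vs \<and>
     edges C = {{vs ! i, vs ! (Suc i mod length vs)} | i. i < length vs})"

text \<open>A cycle of a graph is a subgraph, so the starting point and the direction of
  traversal do not matter when cycles are counted.\<close>

definition unicyclic :: "'a graph \<Rightarrow> bool" where
  "unicyclic G \<longleftrightarrow> connected_graph G \<and> (\<exists>!C. subgraph C G \<and> cycle_graph C)"

definition max_density :: "'a graph \<Rightarrow> real" where
  "max_density G =
     Max {real (card (edges F)) / real (card (verts F)) | F. subgraph F G \<and> 1 \<le> card (verts F)}"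

definition contains_copy :: "'b graph \<Rightarrow> 'a graph \<Rightarrow> bool" where
  "contains_copy G H \<longleftrightarrow> (\<exists>\<phi>. inj_on \<phi> (verts H) \<and> \<phi> ` verts H \<subseteq> verts G \<and>
     (\<forall>e\<in>edges H. \<phi> ` e \<in> edges G))"

definition complete_graph :: "nat \<Rightarrow> nat graph" where
  "complete_graph n = \<lparr>verts = {..<n}, edges = {e. e \<subseteq> {..<n} \<and> card e = 2}\<rparr>"

text \<open>A history is the list, oldest first, of the completed rounds of the game: the edge claimed
  by Avoider together with the set of edges claimed by Enforcer in reply.  Enforcer's reply
  may depend on the whole history and on the edge Avoider has just claimed.\<close>

type_synonym history = "(nat set \<times> nat set set) list"

type_synonym strategy = "history \<Rightarrow> nat set \<Rightarrow> nat set set"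

definition unclaimed :: "nat \<Rightarrow> history \<Rightarrow> nat set set" where
  "unclaimed n h = edges (complete_graph n) - (\<Union>(e, B)\<in>set h. insert e B)"

definition avoider_graph :: "nat \<Rightarrow> history \<Rightarrow> nat graph" where
  "avoider_graph n h = \<lparr>verts = {..<n}, edges = fst ` set h\<rparr>"

text \<open>The histories that can arise when Enforcer follows a given strategy and Avoider plays
  arbitrarily.\<close>

inductive consistent :: "nat \<Rightarrow> strategy \<Rightarrow> history \<Rightarrow> bool" for n \<sigma> where
  start: "consistent n \<sigma> []"
| round: "consistent n \<sigma> h \<Longrightarrow> e \<in> unclaimed n h \<Longrightarrow> consistent n \<sigma> (h @ [(e, \<sigma> h e)])"

text \<open>The minimum covers the end of the game: when fewer than \<open>b\<close> edges are left, Enforcer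
  claims all of them (possibly none).\<close>

definition enforcer_strategy :: "nat \<Rightarrow> nat \<Rightarrow> strategy \<Rightarrow> bool" where
  "enforcer_strategy n b \<sigma> \<longleftrightarrow>
     (\<forall>h e. consistent n \<sigma> h \<and> e \<in> unclaimed n h \<longrightarrow>
        \<sigma> h e \<subseteq> unclaimed n h - {e} \<and>
        card (\<sigma> h e) = min b (card (unclaimed n h - {e})))"

definition enforcer_wins :: "'a graph \<Rightarrow> nat \<Rightarrow> nat \<Rightarrow> bool" where
  "enforcer_wins H n b \<longleftrightarrow>
     (\<exists>\<sigma>. enforcer_strategy n b \<sigma> \<and>
        (\<forall>h. consistent n \<sigma> h \<and> unclaimed n h = {} \<longrightarrow> contains_copy (avoider_graph n h) H))"

text \<open>The value is \<open>0\<close> if Enforcer wins for no positive bias, e.g. if \<open>n\<close> is less than the number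
  of vertices of \<open>H\<close>.  The set is finite if \<open>H\<close> has at least two edges, as Avoider gets only
  one edge when \<open>b\<close> is large.\<close>

definition upper_threshold :: "'a graph \<Rightarrow> nat \<Rightarrow> nat" where
  "upper_threshold H n = Max (insert 0 {b. 1 \<le> b \<and> enforcer_wins H n b})"

end

(* Let k = v(H) and b \<ge> 2 k n.  A cycle of length at most k untouched by Enforcer gets the weight
   (1 + b/k)^-r, where r is the number of its edges that Avoider still misses; the danger of an edge
   is the total weight of the cycles through it, and Avoider always claims an edge of minimum danger.
   A round in which Enforcer claims b edges then does not increase the total weight, because each
   of his edges is at least as dangerous as hers and no cycle is counted more than k times.  The total
   weight is below 1 at the start, so Avoider closes no short cycle before the last round, in which
   Enforcer may have fewer than b edges to claim.  Hence all short cycles of Avoider's final graph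
   pass through her last edge, whereas a copy of H contains two vertex-disjoint short cycles. *)

theory Submission
  imports Defs
begin

section \<open>The potential and one full round\<close>

text \<open>\<open>A\<close> and \<open>E\<close> stand for the edges of Avoider and of Enforcer. A
  set met by \<open>E\<close> is dead, since Avoider can no longer complete it.\<close>

definition potential :: "'e set set \<Rightarrow> real \<Rightarrow> 'e set \<Rightarrow> 'e set \<Rightarrow> real" where
  "potential F \<mu> A E = (\<Sum>X | X \<in> F \<and> X \<inter> E = {}. \<mu> ^ card (X - A))"

definition danger :: "'e set set \<Rightarrow> real \<Rightarrow> 'e set \<Rightarrow> 'e set \<Rightarrow> 'e \<Rightarrow> real" where
  "danger F \<mu> A E f = (\<Sum>X | X \<in> F \<and> X \<inter> E = {} \<and> f \<in> X. \<mu> ^ card (X - A))"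

text \<open>Claiming \<open>e\<close> multiplies the weight of each live set through
  \<open>e\<close> by \<open>1 / \<mu> = 1 + b/k\<close>, a gain of at most \<open>b/k\<close> times
  the danger of \<open>e\<close>. The dangers of the edges in \<open>B\<close> add up to at least
  \<open>b\<close> times that of \<open>e\<close>; this sum counts each killed set at most
  \<open>k\<close> times, so the loss is no smaller than the gain.\<close>

lemma potential_round_le:
  fixes F :: "'e set set" and k :: nat
  assumes F: "finite F" "\<forall>X\<in>F. finite X \<and> card X \<le> k"
    and k: "k > 0" and \<mu>: "\<mu> = 1 / (1 + real b / real k)"
    and e: "e \<notin> A" and B: "finite B" "card B = b"
    and min: "\<And>f. f \<in> B \<Longrightarrow> danger F \<mu> A E e \<le> danger F \<mu> A E f"
  shows "potential F \<mu> (insert e A) (E \<union> B) \<le> potential F \<mu> A E"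
proof -
  define S where "S = {X. X \<in> F \<and> X \<inter> E = {}}"
  define w where "w X = \<mu> ^ card (X - A)" for X
  \<comment> \<open>The relative gain of a weight when Avoider gets one more edge of its set:
    \<open>c = 1 / \<mu> - 1\<close>.\<close>
  define c where "c = real b / real k"
  have S: "finite S" using F by (simp add: S_def)
  have \<mu>0: "\<mu> > 0" unfolding \<mu> by (simp add: add_pos_nonneg)
  have \<mu>c: "\<mu> * (1 + c) = 1"
    unfolding \<mu> c_def using add_pos_nonneg[of 1 "real b / real k"] by simp
  have c0: "c \<ge> 0" by (simp add: c_def)
  have danger_eq: "danger F \<mu> A E f = (\<Sum>X\<in>S. if f \<in> X then w X else 0)" for f
    unfolding danger_def w_def using S
    by (subst sum.inter_filter[symmetric]) (auto simp: S_def conj_assoc intro!: sum.cong)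
  \<comment> \<open>Double counting of the pairs of a live set and an edge of \<open>B\<close> in
    it.\<close>
  have sumB: "(\<Sum>f\<in>B. danger F \<mu> A E f) = (\<Sum>X\<in>S. real (card (X \<inter> B)) * w X)"
  proof -
    have "(\<Sum>f\<in>B. danger F \<mu> A E f) = (\<Sum>X\<in>S. \<Sum>f\<in>B. if f \<in> X then w X else 0)"
      unfolding danger_eq by (rule sum.swap)
    also have "\<dots> = (\<Sum>X\<in>S. real (card (X \<inter> B)) * w X)"
    proof (rule sum.cong[OF refl])
      fix X
      have "(\<Sum>f\<in>B. if f \<in> X then w X else 0) = (\<Sum>f\<in>{f\<in>B. f \<in> X}. w X)"
        using B by (subst sum.inter_filter) auto
      moreover have "{f\<in>B. f \<in> X} = X \<inter> B" by auto
      ultimately show "(\<Sum>f\<in>B. if f \<in> X then w X else 0) = real (card (X \<inter> B)) * w X"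
        by simp
    qed
    finally show ?thesis .
  qed
  \<comment> \<open>The balance of a single set: old weight, gain from \<open>e\<close>, and loss to
    \<open>B\<close>, the last scaled by \<open>k\<close> so that it never exceeds
    \<open>w X\<close>.\<close>
  have pointwise: "(if X \<inter> B = {} then \<mu> ^ card (X - insert e A) else 0)
      \<le> w X + c * (if e \<in> X then w X else 0) - real (card (X \<inter> B)) * w X / real k"
    if X: "X \<in> S" for X
  proof (cases "X \<inter> B = {}")
    case True
    show ?thesis
    proof (cases "e \<in> X")
      case e_in: True
      have "finite (X - insert e A)" using X F by (auto simp: S_def)
      moreover have "X - A = insert e (X - insert e A)" using e e_in by auto
      ultimately have "card (X - A) = Suc (card (X - insert e A))" by 
        (metis card_insert_disjoint DiffD2 insertI1)
      then have "w X + c * w X = (\<mu> * (1 + c)) * \<mu> ^ card (X - insert e A)"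
        by (simp add: w_def algebra_simps)
      then show ?thesis using True e_in \<mu>c by simp
    next
      case False
      then have "X - insert e A = X - A" by auto
      then show ?thesis using True False by (simp add: w_def)
    qed
  next
    case False
    have w0: "w X \<ge> 0" using \<mu>0 by (simp add: w_def)
    have "card (X \<inter> B) \<le> card X" using X F by (auto simp: S_def intro: card_mono)
    then have "card (X \<inter> B) \<le> k" using X F by (force simp: S_def)
    then have "real (card (X \<inter> B)) * w X \<le> real k * w X" using w0 by (simp add: mult_right_mono)
    then have "real (card (X \<inter> B)) * w X / real k \<le> w X" using k by (simp add: divide_simps mult.commute)
    moreover have "c * (if e \<in> X then w X else 0) \<ge> 0" using c0 w0 by simp
    ultimately show ?thesis using False by simp
  qed
  have "potential F \<mu> (insert e A) (E \<union> B)
      = (\<Sum>X\<in>S. if X \<inter> B = {} then \<mu> ^ card (X - insert e A) else 0)"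
    unfolding potential_def using S
    by (subst sum.inter_filter[symmetric]) (auto simp: S_def Int_Un_distrib conj_assoc intro!: sum.cong)
  also have "\<dots> \<le> (\<Sum>X\<in>S. w X + c * (if e \<in> X then w X else 0) - real (card (X \<inter> B)) * w X / real k)"
    by (intro sum_mono pointwise)
  also have "\<dots> = potential F \<mu> A E + c * danger F \<mu> A E e - (\<Sum>f\<in>B. danger F \<mu> A E f) / real k"
    unfolding sumB unfolding danger_eq potential_def w_def S_def[symmetric]
    by (simp add: sum.distrib sum_subtractf sum_distrib_left sum_divide_distrib)
  also have "\<dots> \<le> potential F \<mu> A E"
  proof -
    have "real b * danger F \<mu> A E e \<le> (\<Sum>f\<in>B. danger F \<mu> A E f)"
      using sum_bounded_below[of B "danger F \<mu> A E e" "danger F \<mu> A E"] min B by auto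
    then show ?thesis using k by (simp add: c_def divide_simps)
  qed
  finally show ?thesis .
qed

text \<open>A completed set is still alive because \<open>A\<close> and \<open>E\<close> are
  disjoint, and it alone contributes \<open>\<mu> ^ 0 = 1\<close>.\<close>

lemma potential_less_1D:
  assumes "finite F" "\<mu> \<ge> 0" "potential F \<mu> A E < 1" "A \<inter> E = {}" "X \<in> F"
  shows "\<not> X \<subseteq> A"
proof
  assume "X \<subseteq> A"
  then have X: "X \<in> {X. X \<in> F \<and> X \<inter> E = {}}" "X - A = {}" using assms by auto
  have "\<mu> ^ card (X - A) \<le> potential F \<mu> A E"
    unfolding potential_def using X assms by (intro member_le_sum) auto
  then show False using X assms by simp
qed

section \<open>Avoider's play against a fixed strategy\<close>

lemma unclaimed_snoc: "unclaimed n (h @ [(e, B)]) = unclaimed n h - insert e B"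
  by (auto simp: unclaimed_def)

lemma finite_unclaimed: "finite (unclaimed n h)"
proof -
  have "unclaimed n h \<subseteq> Pow {..<n}" by (auto simp: unclaimed_def complete_graph_def)
  then show ?thesis by (rule finite_subset) simp
qed

lemma consistent_disjoint:
  assumes "enforcer_strategy n b \<sigma>" "consistent n \<sigma> h"
  shows "fst ` set h \<inter> \<Union>(snd ` set h) = {}"
  using assms(2)
proof (induction rule: consistent.induct)
  case (round h e)
  have "\<sigma> h e \<subseteq> unclaimed n h - {e}"
    using assms(1) round.hyps by (auto simp: enforcer_strategy_def)
  moreover have "unclaimed n h \<inter> (fst ` set h \<union> \<Union>(snd ` set h)) = {}"
    by (force simp: unclaimed_def)
  ultimately show ?case using round.IH round.hyps(2) by auto
qed simp

text \<open>Full replies keep the potential below 1, so nothing in \<open>F\<close> is completed by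
  then. A reply of fewer than \<open>b\<close> edges ends the game, and only the edge
  \<open>e\<close> of that round can complete anything. The history is arbitrary to allow induction
  on the number of unclaimed edges.\<close>

lemma avoider_play_through_one_edge:
  fixes F :: "nat set set set"
  assumes F: "finite F" "\<forall>X\<in>F. finite X \<and> card X \<le> k"
    and k: "k > 0" and \<mu>: "\<mu> = 1 / (1 + real b / real k)"
    and \<sigma>: "enforcer_strategy n b \<sigma>" and h: "consistent n \<sigma> h"
    and pot: "potential F \<mu> (fst ` set h) (\<Union>(snd ` set h)) < 1"
  shows "\<exists>h' e. consistent n \<sigma> h' \<and> unclaimed n h' = {} \<and>
           (\<forall>X\<in>F. X \<subseteq> fst ` set h' \<longrightarrow> e \<in> X)"
  using h pot
proof (induction "card (unclaimed n h)" arbitrary: h rule: less_induct)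
  case less
  define A where "A = fst ` set h"
  define E where "E = \<Union>(snd ` set h)"
  define U where "U = unclaimed n h"
  have "\<mu> \<ge> 0" unfolding \<mu> by simp
  then have no: "\<not> X \<subseteq> A" if "X \<in> F" for X
    using potential_less_1D[OF F(1) _ less.prems(2) consistent_disjoint[OF \<sigma> less.prems(1)] that]
    by (simp add: A_def)
  have fin: "finite U" by (simp add: U_def finite_unclaimed)
  show ?case
  proof (cases "U = {}")
    case True
    \<comment> \<open>No member of \<open>F\<close> has been completed, so any \<open>e\<close> will
      do.\<close>
    then show ?thesis using less.prems no by (auto simp: U_def A_def)
  next
    case False
    \<comment> \<open>Minimality over all of \<open>U\<close> covers every reply Enforcer may
      give.\<close>
    define e where "e = arg_min_on (danger F \<mu> A E) U"
    have e: "e \<in> U" unfolding e_def using fin False by (rule arg_min_if_finite)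
    have min: "danger F \<mu> A E e \<le> danger F \<mu> A E f" if "f \<in> U" for f
      unfolding e_def using arg_min_least[OF fin False that] .
    define B where "B = \<sigma> h e"
    define h' where "h' = h @ [(e, B)]"
    have h': "consistent n \<sigma> h'"
      unfolding h'_def B_def using less.prems(1) e by (auto simp: U_def intro: consistent.round)
    have B: "B \<subseteq> U - {e}" "card B = min b (card (U - {e}))"
      using \<sigma> less.prems(1) e by (auto simp: enforcer_strategy_def B_def U_def)
    have finB: "finite B" using B fin by (meson finite_Diff finite_subset)
    have U': "unclaimed n h' = U - insert e B" by (simp add: h'_def unclaimed_snoc U_def)
    have A': "fst ` set h' = insert e A" and E': "\<Union>(snd ` set h') = E \<union> B"
      by (auto simp: h'_def A_def E_def)
    show ?thesis
    proof (cases "b \<le> card (U - {e})")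
      case True
      have "e \<notin> A" using e by (force simp: U_def A_def unclaimed_def)
      then have "potential F \<mu> (insert e A) (E \<union> B) \<le> potential F \<mu> A E"
        using potential_round_le[OF F k \<mu>, of e A B E] B True finB min by auto
      then have "potential F \<mu> (fst ` set h') (\<Union>(snd ` set h')) < 1"
        using less.prems(2) unfolding A' E' A_def E_def by linarith
      moreover have "card (unclaimed n h') < card (unclaimed n h)"
        unfolding U' U_def[symmetric] using e fin by (intro psubset_card_mono) auto
      ultimately show ?thesis using less.hyps h' by blast
    next
      case False
      \<comment> \<open>The short reply takes all that is left. The potential is not controlled
        here, but \<open>no\<close> still describes the position before \<open>e\<close> was
        claimed.\<close>
      then have "B = U - {e}" using B fin by (intro card_subset_eq) auto
      then have "unclaimed n h' = {}" using U' by auto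
      moreover have "\<forall>X\<in>F. X \<subseteq> fst ` set h' \<longrightarrow> e \<in> X" using no unfolding A' by blast
      ultimately show ?thesis using h' by blast
    qed
  qed
qed

section \<open>Short cycles and the initial potential\<close>

text \<open>The edge set of \<open>cycle_graph\<close> as a function of the vertex list, so that
  cycles can be counted by lists and moved by \<open>map\<close>.\<close>

definition cycle_edges :: "'a list \<Rightarrow> 'a set set" where
  "cycle_edges vs = {{vs ! i, vs ! (Suc i mod length vs)} | i. i < length vs}"

lemma cycle_edges_eq_image:
  "cycle_edges vs = (\<lambda>i. {vs ! i, vs ! (Suc i mod length vs)}) ` {..<length vs}"
  by (auto simp: cycle_edges_def)

lemma finite_cycle_edges: "finite (cycle_edges vs)"
  by (simp add: cycle_edges_eq_image)

lemma card_cycle_edges: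
  assumes "distinct vs" "3 \<le> length vs"
  shows "card (cycle_edges vs) = length vs"
proof -
  have "inj_on (\<lambda>i. {vs ! i, vs ! (Suc i mod length vs)}) {..<length vs}"
  proof (rule inj_onI)
    fix i j assume ij: "i \<in> {..<length vs}" "j \<in> {..<length vs}"
      and eq: "{vs ! i, vs ! (Suc i mod length vs)} = {vs ! j, vs ! (Suc j mod length vs)}"
    have lt: "Suc i mod length vs < length vs" "Suc j mod length vs < length vs"
      using assms by (auto intro: mod_less_divisor)
    \<comment> \<open>In the second alternative each index is the cyclic successor of the other,
      which would force a length of at most 2.\<close>
    from eq have "i = j \<or> i = Suc j mod length vs \<and> Suc i mod length vs = j"
      using ij lt assms by (auto simp: doubleton_eq_iff nth_eq_iff_index_eq)
    then show "i = j"
      using ij assms by (auto simp: mod_Suc split: if_splits)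
  qed
  then show ?thesis by (simp add: cycle_edges_eq_image card_image)
qed

lemma cycle_edges_map: "cycle_edges (map \<phi> vs) = (`) \<phi> ` cycle_edges vs"
proof (cases "vs = []")
  case False
  then show ?thesis by (auto simp: cycle_edges_eq_image image_image)
qed (simp add: cycle_edges_def)

text \<open>A cycle is listed once for each starting point and direction. This overcounting is
  harmless for an upper bound on the potential.\<close>

definition short_cycles :: "nat \<Rightarrow> nat \<Rightarrow> nat list set" where
  "short_cycles n k = {vs. distinct vs \<and> 3 \<le> length vs \<and> length vs \<le> k \<and> set vs \<subseteq> {..<n}}"

lemma finite_short_cycles: "finite (short_cycles n k)"
  by (rule finite_subset[OF _ finite_lists_length_le[of "{..<n}" k]]) (auto simp: short_cycles_def)

lemma sum_half_powers_less_1: "(\<Sum>l = 3..k. (1 / 2 :: real) ^ l) < 1"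
proof -
  have "(\<Sum>l = 1..k. (1 / 2 :: real) ^ l) = 1 - (1 / 2) ^ k"
    by (induction k) (auto simp: field_simps)
  moreover have "(\<Sum>l = 3..k. (1 / 2 :: real) ^ l) \<le> (\<Sum>l = 1..k. (1 / 2) ^ l)"
    by (rule sum_mono2) auto
  moreover have "(1 / 2 :: real) ^ k > 0" by simp
  ultimately show ?thesis by linarith
qed

text \<open>At most \<open>n ^ l\<close> lists have length \<open>l\<close>, so they contribute at
  most \<open>(n * \<mu>) ^ l\<close>, which is bounded by a term of a geometric series with ratio
  1/2.\<close>

lemma potential_short_cycles_less_1:
  assumes "\<mu> \<ge> 0" "real n * \<mu> \<le> 1 / 2"
  shows "potential (cycle_edges ` short_cycles n k) \<mu> {} {} < 1"
proof -
  have "potential (cycle_edges ` short_cycles n k) \<mu> {} {}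
      = (\<Sum>X\<in>cycle_edges ` short_cycles n k. \<mu> ^ card X)"
    by (simp add: potential_def)
  also have "\<dots> \<le> (\<Sum>vs\<in>short_cycles n k. \<mu> ^ card (cycle_edges vs))"
    using assms finite_short_cycles
    by (intro sum_image_le[where g = "\<lambda>X. \<mu> ^ card X", unfolded o_def]) auto
  also have "\<dots> = (\<Sum>vs\<in>short_cycles n k. \<mu> ^ length vs)"
    by (intro sum.cong) (auto simp: short_cycles_def card_cycle_edges)
  also have "\<dots> = (\<Sum>l\<in>{3..k}. \<Sum>vs | vs \<in> short_cycles n k \<and> length vs = l. \<mu> ^ length vs)"
    by (rule sum.group[symmetric]) (auto simp: finite_short_cycles, auto simp: short_cycles_def)
  also have "\<dots> \<le> (\<Sum>l\<in>{3..k}. (1 / 2) ^ l)"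
  proof (rule sum_mono)
    fix l
    have "{vs. vs \<in> short_cycles n k \<and> length vs = l} \<subseteq> {vs. set vs \<subseteq> {..<n} \<and> length vs = l}"
      by (auto simp: short_cycles_def)
    from card_mono[OF finite_lists_length_eq this]
    have "card {vs. vs \<in> short_cycles n k \<and> length vs = l} \<le> n ^ l"
      by (simp add: card_lists_length_eq)
    then have "real (card {vs. vs \<in> short_cycles n k \<and> length vs = l}) * \<mu> ^ l \<le> real n ^ l * \<mu> ^ l"
      using assms(1) by (intro mult_right_mono) (auto simp flip: of_nat_power)
    also have "\<dots> \<le> (1 / 2) ^ l"
      unfolding power_mult_distrib[symmetric] using assms by (intro power_mono) auto
    finally show "(\<Sum>vs | vs \<in> short_cycles n k \<and> length vs = l. \<mu> ^ length vs) \<le> (1 / 2) ^ l"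
      by simp
  qed
  also have "\<dots> < 1" by (rule sum_half_powers_less_1)
  finally show ?thesis .
qed

section \<open>Components and their cycles\<close>

lemma connected_graph_Un:
  assumes "connected_graph G" "connected_graph G'" "x \<in> verts G" "x \<in> verts G'"
  shows "connected_graph \<lparr>verts = verts G \<union> verts G', edges = edges G \<union> edges G'\<rparr>"
proof -
  define R where "R = {(x, y). {x, y} \<in> edges G \<union> edges G'}"
  have sub: "{(x, y). {x, y} \<in> edges G}\<^sup>* \<subseteq> R\<^sup>*" "{(x, y). {x, y} \<in> edges G'}\<^sup>* \<subseteq> R\<^sup>*"
    by (rule rtrancl_mono; auto simp: R_def)+
  have "(u, x) \<in> R\<^sup>* \<and> (x, u) \<in> R\<^sup>*" if "u \<in> verts G \<union> verts G'" for u
    using that assms sub unfolding connected_graph_def by blast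
  then have "(u, v) \<in> R\<^sup>*" if "u \<in> verts G \<union> verts G'" "v \<in> verts G \<union> verts G'" for u v
    using that by (meson rtrancl_trans)
  then show ?thesis using assms(3) by (auto simp: connected_graph_def R_def)
qed

text \<open>Two components with a common vertex have a connected union, which by maximality equals
  both of them.\<close>

lemma components_disjoint:
  fixes C C' H :: "'a graph"
  assumes "component C H" "component C' H" "C \<noteq> C'"
  shows "verts C \<inter> verts C' = {}"
proof (rule ccontr)
  assume "verts C \<inter> verts C' \<noteq> {}"
  then obtain x where x: "x \<in> verts C" "x \<in> verts C'" by blast
  define D where "D = \<lparr>verts = verts C \<union> verts C', edges = edges C \<union> edges C'\<rparr>"
  have "connected_graph D"
    unfolding D_def using assms x by (intro connected_graph_Un) (auto simp: component_def)
  moreover have "subgraph D H" "subgraph C D" "subgraph C' D"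
    using assms by (auto simp: D_def component_def subgraph_def simple_graph_def)
  ultimately have "D = C" "D = C'" using assms by (auto simp: component_def)
  then show False using assms(3) by simp
qed

text \<open>The length bound puts the cycle within Avoider's guarded family; the last clause lets
  vertex-disjointness exclude a common edge.\<close>

lemma unicyclic_component_cycle:
  assumes "simple_graph H" "component C H" "unicyclic C"
  obtains vs where "distinct vs" "3 \<le> length vs" "length vs \<le> card (verts H)"
    "set vs \<subseteq> verts C" "verts C \<subseteq> verts H" "cycle_edges vs \<subseteq> edges C" "edges C \<subseteq> edges H"
    "\<And>e. e \<in> edges C \<Longrightarrow> e \<subseteq> verts C \<and> e \<noteq> {}"
proof -
  obtain D where D: "subgraph D C" "cycle_graph D" using assms by (auto simp: unicyclic_def)
  then obtain vs where vs: "distinct vs" "3 \<le> length vs" "verts D = set vs"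
    "edges D = cycle_edges vs"
    by (auto simp: cycle_graph_def cycle_edges_def)
  have C: "simple_graph C" "verts C \<subseteq> verts H" "edges C \<subseteq> edges H"
    using assms by (auto simp: component_def subgraph_def)
  have sub: "set vs \<subseteq> verts C" "cycle_edges vs \<subseteq> edges C" using D vs by (auto simp: subgraph_def)
  have "card (set vs) \<le> card (verts H)"
    using sub C assms(1) by (intro card_mono) (auto simp: simple_graph_def)
  then have "length vs \<le> card (verts H)" using vs by (simp add: distinct_card)
  moreover have "e \<subseteq> verts C \<and> e \<noteq> {}" if "e \<in> edges C" for e
    using C(1) that by (force simp: simple_graph_def)
  ultimately show ?thesis using that vs sub C by blast
qed

section \<open>Copies of \<open>H\<close> and the threshold\<close>

text \<open>An embedding sends a cycle to the cycle through the image vertices, of the same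
  length.\<close>

lemma copy_cycle:
  assumes "inj_on \<phi> (verts H)" "\<phi> ` verts H \<subseteq> {..<n}" "\<forall>e\<in>edges H. \<phi> ` e \<in> A"
    and "distinct vs" "3 \<le> length vs" "length vs \<le> k" "set vs \<subseteq> verts H" "cycle_edges vs \<subseteq> edges H"
  shows "(`) \<phi> ` cycle_edges vs \<in> cycle_edges ` short_cycles n k" "(`) \<phi> ` cycle_edges vs \<subseteq> A"
proof -
  have "inj_on \<phi> (set vs)" by (rule inj_on_subset[OF assms(1,7)])
  then have "map \<phi> vs \<in> short_cycles n k"
    using assms by (auto simp: short_cycles_def distinct_map)
  then show "(`) \<phi> ` cycle_edges vs \<in> cycle_edges ` short_cycles n k"
    using cycle_edges_map by (metis image_eqI)
  show "(`) \<phi> ` cycle_edges vs \<subseteq> A" using assms by auto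
qed

lemma not_enforcer_wins:
  fixes H :: "'a graph"
  assumes H: "simple_graph H" and two: "2 \<le> card {C. component C H \<and> unicyclic C}"
    and b: "2 * card (verts H) * n \<le> b"
  shows "\<not> enforcer_wins H n b"
proof
  assume "enforcer_wins H n b"
  then obtain \<sigma> where \<sigma>: "enforcer_strategy n b \<sigma>"
    and win: "\<And>h. consistent n \<sigma> h \<Longrightarrow> unclaimed n h = {} \<Longrightarrow> contains_copy (avoider_graph n h) H"
    by (auto simp: enforcer_wins_def)
  obtain C C' where C: "component C H" "unicyclic C" and C': "component C' H" "unicyclic C'"
    and "C \<noteq> C'"
    \<comment> \<open>Infinite sets have \<open>card\<close> 0, so \<open>two\<close> also gives the
      finiteness needed to extract two distinct elements.\<close>
    using card_le_Suc0_iff_eq[OF card_ge_0_finite, of "{C. component C H \<and> unicyclic C}"] two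
    by auto
  note disj = components_disjoint[OF C(1) C'(1) \<open>C \<noteq> C'\<close>]
  define k where "k = card (verts H)"
  obtain vs where vs: "distinct vs" "3 \<le> length vs" "length vs \<le> k"
    "set vs \<subseteq> verts C" "verts C \<subseteq> verts H" "cycle_edges vs \<subseteq> edges C" "edges C \<subseteq> edges H"
    "\<And>e. e \<in> edges C \<Longrightarrow> e \<subseteq> verts C \<and> e \<noteq> {}"
    using unicyclic_component_cycle[OF H C] unfolding k_def by blast
  obtain us where us: "distinct us" "3 \<le> length us" "length us \<le> k"
    "set us \<subseteq> verts C'" "verts C' \<subseteq> verts H" "cycle_edges us \<subseteq> edges C'" "edges C' \<subseteq> edges H"
    "\<And>e. e \<in> edges C' \<Longrightarrow> e \<subseteq> verts C' \<and> e \<noteq> {}"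
    using unicyclic_component_cycle[OF H C'] unfolding k_def by blast
  have k: "k > 0" using vs by simp
  define \<mu> where "\<mu> = 1 / (1 + real b / real k)"
  define F where "F = cycle_edges ` short_cycles n k"
  have F: "finite F" "\<forall>X\<in>F. finite X \<and> card X \<le> k"
    by (auto simp: F_def finite_short_cycles finite_cycle_edges)
      (auto simp: short_cycles_def card_cycle_edges)
  \<comment> \<open>The bias enters only here: \<open>b / k \<ge> 2 * n\<close> gives
    \<open>n * \<mu> \<le> 1 / 2\<close>, as the geometric series requires.\<close>
  have "real (2 * k * n) \<le> real b" using b unfolding k_def of_nat_le_iff .
  then have "2 * real n \<le> real b / real k" using k by (simp add: field_simps)
  then have "real n * \<mu> \<le> 1 / 2" using k by (simp add: \<mu>_def divide_simps add_pos_nonneg)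
  then have "potential F \<mu> (fst ` set []) (\<Union>(snd ` set [])) < 1"
    using potential_short_cycles_less_1[of \<mu> n k] by (simp add: F_def \<mu>_def)
  then have "\<exists>h e. consistent n \<sigma> h \<and> unclaimed n h = {} \<and> (\<forall>X\<in>F. X \<subseteq> fst ` set h \<longrightarrow> e \<in> X)"
    by (rule avoider_play_through_one_edge[OF F k \<mu>_def \<sigma> consistent.start])
  then obtain h e where h: "consistent n \<sigma> h" "unclaimed n h = {}"
    and e: "\<forall>X\<in>F. X \<subseteq> fst ` set h \<longrightarrow> e \<in> X"
    by (elim exE conjE)
  obtain \<phi> where \<phi>: "inj_on \<phi> (verts H)" "\<phi> ` verts H \<subseteq> {..<n}" "\<forall>e\<in>edges H. \<phi> ` e \<in> fst ` set h"
    using win[OF h] by (auto simp: contains_copy_def avoider_graph_def)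
  have "e \<in> (`) \<phi> ` cycle_edges vs"
    using e[unfolded F_def, THEN bspec, THEN mp, OF copy_cycle[OF \<phi> vs(1-3) subset_trans[OF vs(4,5)]
        subset_trans[OF vs(6,7)]]] .
  then obtain f where f: "f \<in> edges C" "e = \<phi> ` f" using vs by blast
  have "e \<in> (`) \<phi> ` cycle_edges us"
    using e[unfolded F_def, THEN bspec, THEN mp, OF copy_cycle[OF \<phi> us(1-3) subset_trans[OF us(4,5)]
        subset_trans[OF us(6,7)]]] .
  then obtain g where g: "g \<in> edges C'" "e = \<phi> ` g" using us by blast
  \<comment> \<open>Both \<open>f\<close> and \<open>g\<close> are preimages of \<open>e\<close>, so
    injectivity of \<open>\<phi>\<close> identifies them; a nonempty edge would then lie in two
    disjoint components.\<close>
  have "f \<subseteq> verts C" "f \<noteq> {}" "g \<subseteq> verts C'" using f g vs(8) us(8) by auto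
  moreover from this have "f = g"
    using f g inj_on_image_eq_iff[OF \<phi>(1), of f g] vs(5) us(5) by auto
  ultimately show False using disj by blast
qed

theorem theorem1p6:
  fixes H :: "'a graph"
  assumes "simple_graph H"
    and "\<not> connected_graph H"
    and "max_density H = 1"
    and "2 \<le> card {C. component C H \<and> unicyclic C}"
  shows "(\<lambda>n. real (upper_threshold H n)) \<in> O(\<lambda>n. real n)"
proof (rule bigoI)
  define k where "k = card (verts H)"
  have "upper_threshold H n \<le> 2 * k * n" for n
  proof -
    \<comment> \<open>Besides bounding the winning biases, this makes their set finite, so that
      \<open>Max\<close> is a genuine maximum.\<close>
    have "{b. 1 \<le> b \<and> enforcer_wins H n b} \<subseteq> {..2 * k * n}"
      using not_enforcer_wins[OF assms(1,4), of n] unfolding k_def by (auto intro: leI dest: less_imp_le)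
    then have "insert 0 {b. 1 \<le> b \<and> enforcer_wins H n b} \<subseteq> {..2 * k * n}" by auto
    moreover from this have "finite (insert 0 {b. 1 \<le> b \<and> enforcer_wins H n b})"
      by (rule finite_subset) simp
    ultimately show ?thesis unfolding upper_threshold_def by (subst Max_le_iff) auto
  qed
  then have "real (upper_threshold H n) \<le> real (2 * k) * real n" for n
    by (metis of_nat_le_iff of_nat_mult)
  then show "\<forall>\<^sub>F n in at_top. norm (real (upper_threshold H n)) \<le> real (2 * k) * norm (real n)"
    by simp
qed

end
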